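(* If $n\geq 5$ is an integer, then $\rho(Q_n) \in \{1 + \lceil \log_2 n\rceil,\ 2 + \lceil \log_2 n\rceil\}$.
   Context: $Q_n$ is the $n$-dimensional hypercube graph: its vertices are the binary strings of length $n$ and two vertices are adjacent iff they differ in exactly one coordinate. A labeling of the vertices of a graph $G$ with two labels is 2-distinguishing if no nontrivial automorphism of $G$ preserves the labels; $G$ is 2-distinguishable if it has such a labeling ($Q_n$ is 2-distinguishable for $n\ge 4$). For a 2-distinguishable graph $G$, $\rho(G)$, the cost of 2-distinguishing, is the minimum size of a label class over all 2-distinguishing labelings of $G$. *)

theory Defs
  imports Complex_Main "Graph_Theory.Pair_Digraph"
begin

text \<open>
  As in the locale \<^locale>\<open>pair_graph\<close>, a finite simple graph is a symmetric loop-free digraph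
  without parallel arcs, each edge being represented by its two orientations.
\<close>

definition hypercube :: "nat \<Rightarrow> bool list pair_pre_digraph" where
  "hypercube n =
    \<lparr> pverts = {u. length u = n},
      parcs = {(u, v). length u = n \<and> length v = n \<and> card {i. i < n \<and> u ! i \<noteq> v ! i} = 1} \<rparr>"

lemma pair_graph_hypercube: "pair_graph (hypercube n)"
proof -
  have fin: "finite {u :: bool list. length u = n}"
    using finite_lists_length_eq[of "UNIV :: bool set" n] by simp
  have "parcs (hypercube n) \<subseteq> {u. length u = n} \<times> {u. length u = n}"
    by (auto simp: hypercube_def)
  then have fin_arcs: "finite (parcs (hypercube n))"
    by (rule finite_subset) (intro finite_cartesian_product fin)
  have sym: "sym (parcs (hypercube n))"
  proof (rule symI)
    fix u v assume uv: "(u, v) \<in> parcs (hypercube n)"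
    have "{i. i < n \<and> v ! i \<noteq> u ! i} = {i. i < n \<and> u ! i \<noteq> v ! i}"
      by auto
    then have "card {i. i < n \<and> v ! i \<noteq> u ! i} = card {i. i < n \<and> u ! i \<noteq> v ! i}"
      by (rule arg_cong)
    with uv show "(v, u) \<in> parcs (hypercube n)"
      unfolding hypercube_def by auto
  qed
  show ?thesis
  proof
    fix e assume "e \<in> parcs (hypercube n)"
    then obtain u v where e: "e = (u, v)" and uv: "length u = n" "length v = n"
        "card {i. i < n \<and> u ! i \<noteq> v ! i} = 1"
      unfolding hypercube_def by auto
    show "fst e \<in> pverts (hypercube n)" "snd e \<in> pverts (hypercube n)"
      using uv by (simp_all add: e hypercube_def)
    show "fst e \<noteq> snd e"
    proof
      assume "fst e = snd e"
      then have "u = v" by (simp add: e)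
      with uv(3) show False by simp
    qed
  next
    show "finite (pverts (hypercube n))"
      using fin by (simp add: hypercube_def)
  next
    show "finite (parcs (hypercube n))"
      by (rule fin_arcs)
  next
    show "symmetric (with_proj (hypercube n))"
      using sym by (simp add: symmetric_def)
  qed
qed

text \<open>Only the values of an automorphism on the vertex set matter.\<close>

definition automorphism :: "'a pair_pre_digraph \<Rightarrow> ('a \<Rightarrow> 'a) \<Rightarrow> bool" where
  "automorphism G f \<longleftrightarrow>
    bij_betw f (pverts G) (pverts G) \<and>
    (\<forall>u \<in> pverts G. \<forall>v \<in> pverts G. (f u, f v) \<in> parcs G \<longleftrightarrow> (u, v) \<in> parcs G)"

text \<open>The two labels are the truth values, so a labeling with two labels is a predicate.\<close>

definition two_distinguishing :: "'a pair_pre_digraph \<Rightarrow> ('a \<Rightarrow> bool) \<Rightarrow> bool" where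
  "two_distinguishing G l \<longleftrightarrow>
    \<not> (\<exists>f. automorphism G f \<and> (\<exists>v \<in> pverts G. f v \<noteq> v) \<and> (\<forall>v \<in> pverts G. l (f v) = l v))"

text \<open>
  The minimum is taken over both label classes of every 2-distinguishing labeling. It is meant for
  finite graphs that have a 2-distinguishing labeling; otherwise no such minimum need exist.
\<close>

definition cost2 :: "'a pair_pre_digraph \<Rightarrow> nat" where
  "cost2 G =
    (LEAST k. \<exists>l b. two_distinguishing G l \<and> k = card {v \<in> pverts G. l v = b})"

end

theory Submission
  imports Defs
begin

text \<open>
  A label class with \<open>m\<close> vertices is an \<open>m \<times> n\<close> Boolean matrix, with one row for each vertex and
  one column for each coordinate. Flipping a coordinate complements its column, so up to the
  automorphisms of the cube a column matters only as a bipartition of the \<open>m\<close> rows.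

  If two coordinates give the same bipartition, exchanging them, with a flip of both if the
  columns are complementary, moves some vertex but fixes every row, so the labeling is not
  2-distinguishing (\<open>two_distinguishing_columns\<close>). There are \<open>2 ^ (m - 1)\<close> bipartitions of
  \<open>m\<close> rows, hence \<open>n \<le> 2 ^ (m - 1)\<close>, which is the lower bound.

  Conversely, let the columns represent \<open>n\<close> distinct bipartitions. An automorphism of the cube
  permutes coordinates and flips some of them (\<open>automorphism_hypercubeE\<close>). If it preserves the set
  of rows, it permutes the rows in a way that preserves the family of bipartitions. If the
  identity is the only permutation of the rows that does so, every column is fixed as a
  bipartition, no coordinate is moved or flipped, and the labeling is 2-distinguishing
  (\<open>rigid_imp_two_distinguishing\<close>). So the upper bound asks for a rigid family of exactly \<open>n\<close>
  bipartitions of \<open>m = \<lceil>log 2 n\<rceil> + 2\<close> rows, that is, with \<open>2 ^ (m - 3) < n \<le> 2 ^ (m - 2)\<close>.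

  Such a family can be left almost entirely free. Regard the rows \<open>0, \<dots>, m - 1\<close> as a path, and
  describe a bipartition by its smaller side. Rigidity follows if among the two-element sides
  exactly the edges of the path occur, the side \<open>{0}\<close> occurs, and the side \<open>{m - 1}\<close> does not: a
  permutation preserving the family then maps the path to itself and cannot reverse it. This
  requires only \<open>m\<close> bipartitions and excludes at most half of all \<open>2 ^ (m - 1)\<close> when
  \<open>m \<ge> 5\<close>, so every number from \<open>m\<close> to \<open>2 ^ (m - 2)\<close> is the size of such a family
  (\<open>ex_rigid_family\<close>).
\<close>

section \<open>Automorphisms of the hypercube\<close>

definition hamming :: "nat \<Rightarrow> bool list \<Rightarrow> bool list \<Rightarrow> nat" where
  "hamming n u v = card {i. i < n \<and> u ! i \<noteq> v ! i}"

lemma pverts_hypercube [simp]: "pverts (hypercube n) = {u. length u = n}"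
  by (simp add: hypercube_def)

lemma parcs_hypercube:
  "length u = n \<Longrightarrow> length v = n \<Longrightarrow> (u, v) \<in> parcs (hypercube n) \<longleftrightarrow> hamming n u v = 1"
  by (simp add: hypercube_def hamming_def)

lemma hamming_commute: "hamming n u v = hamming n v u"
  unfolding hamming_def by (rule arg_cong[of _ _ card]) auto

lemma hamming_triangle: "hamming n u w \<le> hamming n u v + hamming n v w"
proof -
  have "{i. i < n \<and> u ! i \<noteq> w ! i} \<subseteq> {i. i < n \<and> u ! i \<noteq> v ! i} \<union> {i. i < n \<and> v ! i \<noteq> w ! i}"
    by auto
  then have "hamming n u w \<le> card ({i. i < n \<and> u ! i \<noteq> v ! i} \<union> {i. i < n \<and> v ! i \<noteq> w ! i})"
    unfolding hamming_def by (intro card_mono) auto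
  also have "\<dots> \<le> hamming n u v + hamming n v w"
    unfolding hamming_def by (rule card_Un_le)
  finally show ?thesis .
qed

lemma hamming_flip:
  assumes "length u = n" "j < n"
  shows "hamming n (u[j := \<not> u ! j]) v =
    (if u ! j = v ! j then Suc (hamming n u v) else hamming n u v - 1)"
proof (cases "u ! j = v ! j")
  case True
  then have "{i. i < n \<and> u[j := \<not> u ! j] ! i \<noteq> v ! i} = insert j {i. i < n \<and> u ! i \<noteq> v ! i}"
    using assms by (auto simp: nth_list_update)
  then show ?thesis
    using True by (simp add: hamming_def)
next
  case False
  then have "{i. i < n \<and> u[j := \<not> u ! j] ! i \<noteq> v ! i} = {i. i < n \<and> u ! i \<noteq> v ! i} - {j}"
    using assms by (auto simp: nth_list_update)
  then show ?thesis
    using False assms by (simp add: hamming_def)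
qed

lemma hamming_eq_0:
  assumes "length u = n" "length v = n" "hamming n u v = 0"
  shows "u = v"
  using assms by (intro nth_equalityI) (auto simp: hamming_def)

lemma hamming_self: "hamming n u u = 0"
  by (simp add: hamming_def)

lemma hamming_eq_1:
  assumes "length u = n" "length v = n" "hamming n u v = 1"
  obtains j where "j < n" "v = u[j := \<not> u ! j]"
proof -
  obtain j where j: "{i. i < n \<and> u ! i \<noteq> v ! i} = {j}"
    using assms(3) unfolding hamming_def by (rule card_1_singletonE)
  then have jn: "j < n" "u ! j \<noteq> v ! j"
    by auto
  then have "hamming n (u[j := \<not> u ! j]) v = 0"
    using hamming_flip[of u n j v] assms by simp
  then have "u[j := \<not> u ! j] = v"
    using assms by (intro hamming_eq_0[of _ n]) simp_all
  then show thesis using that jn by blast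
qed

text \<open>
  The Hamming distance is the path metric of the cube: a point at distance \<open>k + 1\<close> from \<open>v\<close> has a
  neighbour at distance \<open>k\<close>. A map that preserves edges therefore cannot increase distances.
\<close>

lemma edge_map_contracts:
  assumes len: "\<And>u. length u = n \<Longrightarrow> length (f u) = n"
    and edge: "\<And>u v. length u = n \<Longrightarrow> length v = n \<Longrightarrow> hamming n u v = 1 \<Longrightarrow> hamming n (f u) (f v) = 1"
    and "length u = n" "length v = n"
  shows "hamming n (f u) (f v) \<le> hamming n u v"
  using assms(3,4)
proof (induction "hamming n u v" arbitrary: u)
  case 0
  then have "u = v" using hamming_eq_0 by simp
  then show ?case by (simp add: hamming_self)
next
  case (Suc k)
  then have "{i. i < n \<and> u ! i \<noteq> v ! i} \<noteq> {}"
    unfolding hamming_def by (metis card.empty nat.simps(3))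
  then obtain j where j: "j < n" "u ! j \<noteq> v ! j" by blast
  define w where "w = u[j := \<not> u ! j]"
  have w: "length w = n" "hamming n w v = k" "hamming n w u = 1"
    using hamming_flip[of u n j] j Suc by (simp_all add: w_def hamming_self)
  have "hamming n (f u) (f v) \<le> hamming n (f w) (f u) + hamming n (f w) (f v)"
    using hamming_triangle hamming_commute by metis
  also have "\<dots> \<le> 1 + k"
    using Suc.hyps(1)[of w] w edge[of w u] Suc.prems by simp
  finally show ?case using Suc by simp
qed

text \<open>
  Neither an automorphism nor its inverse increases distances.
\<close>

lemma automorphism_hamming:
  assumes "automorphism (hypercube n) f" "length u = n" "length v = n"
  shows "hamming n (f u) (f v) = hamming n u v"
proof -
  let ?V = "{u :: bool list. length u = n}"
  have bij: "bij_betw f ?V ?V"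
    and edge: "\<And>u v. length u = n \<Longrightarrow> length v = n \<Longrightarrow> (f u, f v) \<in> parcs (hypercube n) \<longleftrightarrow> (u, v) \<in> parcs (hypercube n)"
    using assms(1) by (auto simp: automorphism_def)
  have len: "length (f u) = n" if "length u = n" for u
    using bij that by (auto simp: bij_betw_def)
  have edge': "hamming n (f u) (f v) = 1 \<longleftrightarrow> hamming n u v = 1"
    if "length u = n" "length v = n" for u v
    using edge[OF that] parcs_hypercube that len by simp
  let ?g = "inv_into ?V f"
  have glen: "length (?g u) = n" if "length u = n" for u
    using inv_into_into[of u f ?V] bij that by (auto simp: bij_betw_def)
  have fg: "f (?g u) = u" if "length u = n" for u
    using bij_betw_inv_into_right[OF bij] that by simp
  have gf: "?g (f u) = u" if "length u = n" for u
    using bij_betw_inv_into_left[OF bij] that by simp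
  have "hamming n (?g (f u)) (?g (f v)) \<le> hamming n (f u) (f v)"
  proof (rule edge_map_contracts)
    fix a b :: "bool list" assume "length a = n" "length b = n" "hamming n a b = 1"
    then show "hamming n (?g a) (?g b) = 1"
      using edge'[of "?g a" "?g b"] glen fg by simp
  qed (use glen len assms in auto)
  moreover have "hamming n (f u) (f v) \<le> hamming n u v"
    using len edge' assms by (intro edge_map_contracts) auto
  ultimately show ?thesis using gf assms by simp
qed

text \<open>
  An isometry maps the neighbours of the zero vertex \<open>z\<close> to the neighbours of \<open>f z\<close>, which
  defines the map \<open>p\<close> on coordinates. Coordinate \<open>i\<close> of \<open>v\<close> can be read off from distances: it is
  \<open>True\<close> iff \<open>v\<close> is closer to the unit vertex \<open>e i\<close> than to \<open>z\<close>. Distances being preserved, this says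
  that \<open>f v\<close> differs from \<open>f z\<close> in coordinate \<open>p i\<close>.
\<close>

lemma automorphism_hypercubeE:
  assumes aut: "automorphism (hypercube n) f"
  obtains p c where "inj_on p {..<n}" "p ` {..<n} \<subseteq> {..<n}"
    "\<And>v i. length v = n \<Longrightarrow> i < n \<Longrightarrow> f v ! p i = (v ! i \<noteq> c i)"
proof -
  let ?V = "{u :: bool list. length u = n}"
  define z where "z = replicate n False"
  define e where "e i = z[i := \<not> z ! i]" for i
  have bij: "bij_betw f ?V ?V"
    using aut by (simp add: automorphism_def)
  have len: "length (f u) = n" if "length u = n" for u
    using bij that by (auto simp: bij_betw_def)
  have z: "length z = n" and e: "length (e i) = n" for i
    by (simp_all add: z_def e_def)
  have "\<exists>q. q < n \<and> f (e i) = (f z)[q := \<not> f z ! q]" if "i < n" for i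
  proof -
    have "hamming n (e i) z = 1"
      using hamming_flip[OF z that] by (simp add: e_def hamming_self)
    then have "hamming n (f z) (f (e i)) = 1"
      using automorphism_hamming[OF aut] z e hamming_commute by metis
    then show ?thesis
      using hamming_eq_1 len z e by metis
  qed
  then obtain p where p: "\<And>i. i < n \<Longrightarrow> p i < n"
      "\<And>i. i < n \<Longrightarrow> f (e i) = (f z)[p i := \<not> f z ! p i]"
    by metis
  have inj: "inj_on p {..<n}"
  proof (rule inj_onI)
    fix i j assume ij: "i \<in> {..<n}" "j \<in> {..<n}" "p i = p j"
    then have "f (e i) = f (e j)" using p by simp
    then have "e i = e j"
      using bij e by (auto simp: bij_betw_def inj_on_def)
    then have "e i ! i = e j ! i" by simp
    then show "i = j"
      using ij by (auto simp: e_def z_def nth_list_update split: if_splits)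
  qed
  have "f v ! p i = (v ! i \<noteq> f z ! p i)" if v: "length v = n" and i: "i < n" for v i
  proof -
    have "hamming n (f (e i)) (f v) = hamming n (e i) v" "hamming n (f z) (f v) = hamming n z v"
      using automorphism_hamming[OF aut] e z v by auto
    then have "(f z ! p i = f v ! p i) \<longleftrightarrow> (z ! i = v ! i)"
      using hamming_flip[OF z i, of v] hamming_flip[OF len[OF z] p(1)[OF i], of "f v"] p(2)[OF i]
      by (auto simp: e_def split: if_splits)
    moreover have "z ! i = False" using i by (simp add: z_def)
    ultimately show ?thesis by auto
  qed
  then show thesis
    using that[of p "\<lambda>i. f z ! p i"] inj p by auto
qed

section \<open>The lower bound\<close>

definition swap_coords :: "nat \<Rightarrow> nat \<Rightarrow> bool \<Rightarrow> bool list \<Rightarrow> bool list" where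
  "swap_coords i j d v = v[i := (v ! j \<noteq> d), j := (v ! i \<noteq> d)]"

lemma automorphism_swap_coords:
  assumes "i < n" "j < n" "i \<noteq> j"
  shows "automorphism (hypercube n) (swap_coords i j d)"
proof -
  let ?f = "swap_coords i j d"
  let ?t = "Transposition.transpose i j"
  have len: "length (?f v) = length v" for v
    by (simp add: swap_coords_def)
  have invol: "?f (?f v) = v" if "length v = n" for v
    using assms that
    by (intro nth_equalityI) (auto simp: swap_coords_def nth_list_update)
  have nth: "?f v ! k = (v ! ?t k \<noteq> (d \<and> (k = i \<or> k = j)))" if "length v = n" for v k
    using assms that by (auto simp: swap_coords_def nth_list_update Transposition.transpose_def)
  have ham: "hamming n (?f u) (?f v) = hamming n u v" if "length u = n" "length v = n" for u v
  proof -
    have "{k. k < n \<and> ?f u ! k \<noteq> ?f v ! k} = ?t ` {k. k < n \<and> u ! k \<noteq> v ! k}"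
      (is "?L = ?t ` ?R")
    proof
      show "?L \<subseteq> ?t ` ?R"
      proof
        fix k assume "k \<in> ?L"
        then have "?t k \<in> ?R"
          using nth that assms by (auto simp: Transposition.transpose_def)
        then have "?t (?t k) \<in> ?t ` ?R" by (rule imageI)
        then show "k \<in> ?t ` ?R" by simp
      qed
      show "?t ` ?R \<subseteq> ?L"
        using nth that assms by (auto simp: Transposition.transpose_def)
    qed
    moreover have "inj_on ?t ?R"
      by (rule inj_on_subset[OF inj_transpose]) simp
    ultimately show ?thesis
      by (simp add: hamming_def card_image)
  qed
  have "bij_betw ?f {u. length u = n} {u. length u = n}"
    by (rule bij_betw_byWitness[where f' = ?f]) (use len invol in auto)
  then show ?thesis
    using ham len by (simp add: automorphism_def parcs_hypercube)
qed

text \<open>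
  The condition on \<open>d\<close> says that on the class of label \<open>b\<close> the columns \<open>i\<close> and \<open>j\<close> are neither
  equal (\<open>d = False\<close>) nor complementary (\<open>d = True\<close>). Otherwise \<open>swap_coords i j d\<close> fixes
  this class pointwise. Being an involution, it then also preserves the other class.
\<close>

lemma two_distinguishing_columns:
  assumes td: "two_distinguishing (hypercube n) l"
    and ij: "i < n" "j < n" "i \<noteq> j"
  shows "\<exists>v. length v = n \<and> l v = b \<and> v ! i \<noteq> (v ! j \<noteq> d)"
proof (rule ccontr)
  let ?f = "swap_coords i j d"
  assume "\<not> ?thesis"
  then have col: "v ! i = (v ! j \<noteq> d)" if "length v = n" "l v = b" for v
    using that by blast
  have fixed: "?f v = v" if "length v = n" "l v = b" for v
    using col[OF that] that ij by (intro nth_equalityI) (auto simp: swap_coords_def nth_list_update)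
  have "l (?f v) = l v" if v: "length v = n" for v
  proof (cases "l v = b")
    case True
    then show ?thesis using fixed v by simp
  next
    case False
    have invol: "?f (?f v) = v"
      using ij v by (intro nth_equalityI) (auto simp: swap_coords_def nth_list_update)
    have "length (?f v) = n"
      using v by (simp add: swap_coords_def)
    then have "l (?f v) \<noteq> b"
      using fixed invol False by metis
    then show ?thesis using False by simp
  qed
  moreover
  \<comment> \<open>a vertex that violates the relation between the columns, and so is moved\<close>
  define x where "x = (replicate n False)[i := \<not> d]"
  have "?f x ! i = d" "x ! i = (\<not> d)" "length x = n"
    using ij by (simp_all add: x_def swap_coords_def)
  then have "\<exists>v \<in> pverts (hypercube n). ?f v \<noteq> v"
    by (intro bexI[of _ x]) auto
  ultimately show False
    using td automorphism_swap_coords[OF ij, of d] unfolding two_distinguishing_def by auto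
qed

lemma finite_label_class: "finite {v :: bool list. length v = n \<and> P v}"
  by (rule finite_subset[OF _ finite_lists_length_eq[of "UNIV :: bool set" n]]) auto

text \<open>
  Translating a vertex \<open>s\<close> of the class to the origin makes all columns vanish in row \<open>s\<close>. The columns
  then represent distinct bipartitions and so are distinct subsets of the other rows.
\<close>

lemma two_distinguishing_class_card:
  assumes td: "two_distinguishing (hypercube n) l" and "n \<ge> 2"
    and C: "C = {v. length v = n \<and> l v = b}"
  shows "n \<le> 2 ^ (card C - 1)"
proof -
  have fin: "finite C"
    using finite_label_class C by simp
  obtain s where s: "s \<in> C"
    using two_distinguishing_columns[OF td, of 0 1 b] \<open>n \<ge> 2\<close> C by auto
  have "inj_on (\<lambda>i. {v \<in> C. v ! i \<noteq> s ! i}) {..<n}"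
  proof (rule inj_onI, rule ccontr)
    fix i j assume ij: "i \<in> {..<n}" "j \<in> {..<n}" "i \<noteq> j"
      and eq: "{v \<in> C. v ! i \<noteq> s ! i} = {v \<in> C. v ! j \<noteq> s ! j}"
    obtain v where "v \<in> C" "v ! i \<noteq> (v ! j \<noteq> (s ! i \<noteq> s ! j))"
      using two_distinguishing_columns[OF td, of i j b "s ! i \<noteq> s ! j"] ij C by auto
    moreover from this have "(v ! i \<noteq> s ! i) = (v ! j \<noteq> s ! j)"
      using eq by blast
    ultimately show False by auto
  qed
  moreover have "(\<lambda>i. {v \<in> C. v ! i \<noteq> s ! i}) ` {..<n} \<subseteq> Pow (C - {s})"
    by auto
  ultimately have "card {..<n} \<le> card (Pow (C - {s}))"
    using fin by (intro card_inj_on_le) auto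
  then show ?thesis
    using fin s by (simp add: card_Pow)
qed

section \<open>Labelings from rigid families of bipartitions\<close>

text \<open>
  The bipartition of \<open>{..<m}\<close> into \<open>A\<close> and its complement is represented by the side that avoids \<open>0\<close>.
\<close>

definition part :: "nat \<Rightarrow> nat set \<Rightarrow> nat set" where
  "part m A = (if 0 \<in> A then {..<m} - A else A)"

text \<open>
  A rigid family is a set of bipartitions, each given by its side avoiding \<open>0\<close>, for which only the
  identity among the permutations of \<open>{..<m}\<close> maps the family into itself.
\<close>

definition rigid :: "nat \<Rightarrow> nat set set \<Rightarrow> bool" where
  "rigid m F \<longleftrightarrow> F \<subseteq> Pow {1..<m} \<and>
    (\<forall>t. bij_betw t {..<m} {..<m} \<and> (\<forall>A \<in> F. part m (t ` A) \<in> F) \<longrightarrow> (\<forall>r<m. t r = r))"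

lemma rigidD:
  assumes "rigid m F" "bij_betw t {..<m} {..<m}" "\<And>A. A \<in> F \<Longrightarrow> part m (t ` A) \<in> F" "r < m"
  shows "t r = r"
  using assms unfolding rigid_def by blast

lemma part_subset: "A \<subseteq> {..<m} \<Longrightarrow> part m A \<in> Pow {1..<m}"
proof -
  assume "A \<subseteq> {..<m}"
  then have "part m A \<subseteq> {..<m} - {0}"
    by (auto simp: part_def)
  moreover have "{..<m} - {0} = {1..<m}"
    by auto
  ultimately show ?thesis by simp
qed

lemma part_Diff: "0 < m \<Longrightarrow> A \<subseteq> {..<m} \<Longrightarrow> part m ({..<m} - A) = part m A"
  by (auto simp: part_def)

lemma part_eqD:
  assumes "part m A = part m B" "A \<subseteq> {..<m}" "B \<subseteq> {..<m}"
  shows "A = B \<or> A = {..<m} - B"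
  using assms by (auto simp: part_def split: if_splits)

lemma part_image_part:
  assumes t: "bij_betw t {..<m} {..<m}" and "A \<subseteq> {..<m}" "0 < m"
  shows "part m (t ` part m A) = part m (t ` A)"
proof (cases "0 \<in> A")
  case True
  have "t ` ({..<m} - A) = {..<m} - t ` A"
    using t assms(2) inj_on_image_set_diff[of t "{..<m}" "{..<m}" A] by (auto simp: bij_betw_def)
  moreover have "t ` A \<subseteq> {..<m}"
    using t assms(2) by (auto simp: bij_betw_def)
  ultimately show ?thesis
    using True part_Diff assms(3) by (simp add: part_def[of m A])
qed (simp add: part_def[of m A])

text \<open>
  Two points that no member separates could be exchanged.
\<close>

lemma rigid_separates:
  assumes rigid: "rigid m F" and "r < m" "q < m" "r \<noteq> q"
  shows "\<exists>A \<in> F. (r \<in> A) \<noteq> (q \<in> A)"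
proof (rule ccontr)
  assume "\<not> ?thesis"
  then have same: "r \<in> A \<longleftrightarrow> q \<in> A" if "A \<in> F" for A
    using that by blast
  let ?t = "Transposition.transpose r q"
  have "?t ` A = A" if "A \<in> F" for A
    using same[OF that] by (simp add: transpose_image_eq)
  moreover have "part m A = A" if "A \<in> F" for A
    using rigid that unfolding rigid_def part_def by force
  moreover have "bij_betw ?t {..<m} {..<m}"
    by (rule bij_betw_byWitness[where f' = ?t])
      (use assms in \<open>auto simp: Transposition.transpose_def\<close>)
  ultimately have "?t r = r"
    using rigidD[OF rigid, of ?t r] assms(2) by metis
  then show False using assms(4) by simp
qed

text \<open>
  The members of the family are used as the columns of a matrix whose rows \<open>s r\<close> form the label
  class. Rows are distinct since a rigid family separates points. An automorphism \<open>f\<close> that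
  preserves the class induces a permutation \<open>t\<close> of row indices, and its action on coordinates
  shows that \<open>t\<close> preserves the family. Hence \<open>t\<close> is the identity, and this determines \<open>f\<close>.
\<close>

lemma rigid_imp_two_distinguishing:
  assumes rigid: "rigid m F" and card: "card F = n" and "0 < m"
  shows "\<exists>l b. two_distinguishing (hypercube n) l \<and> m = card {v \<in> pverts (hypercube n). l v = b}"
proof -
  have F: "F \<subseteq> Pow {1..<m}"
    using rigid by (simp add: rigid_def)
  then have "finite F"
    by (rule finite_subset) simp
  then obtain h where h: "bij_betw h {..<n} F"
    using card ex_bij_betw_nat_finite[of F] by (auto simp: atLeast0LessThan)
  have hF: "h i \<in> F" if "i < n" for i
    using h that by (auto simp: bij_betw_def)
  have hsub: "h i \<subseteq> {..<m}" "0 \<notin> h i" if "i < n" for i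
  proof -
    have "h i \<subseteq> {1..<m}"
      using hF[OF that] F by blast
    then show "h i \<subseteq> {..<m}" "0 \<notin> h i" by auto
  qed
  define s where "s r = map (\<lambda>i. r \<in> h i) [0..<n]" for r
  have len_s: "length (s r) = n" for r
    by (simp add: s_def)
  have nth_s: "s r ! i \<longleftrightarrow> r \<in> h i" if "i < n" for r i
    using that by (simp add: s_def)
  have inj_s: "inj_on s {..<m}"
  proof (rule inj_onI, rule ccontr)
    fix r q assume rq: "r \<in> {..<m}" "q \<in> {..<m}" "s r = s q" "r \<noteq> q"
    then obtain A where "A \<in> F" "(r \<in> A) \<noteq> (q \<in> A)"
      using rigid_separates[OF rigid] by blast
    moreover from this obtain i where "i < n" "A = h i"
      using h by (auto simp: bij_betw_def)
    ultimately show False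
      using nth_s[of i r] nth_s[of i q] rq(3) by simp
  qed
  let ?S = "s ` {..<m}"
  have "two_distinguishing (hypercube n) (\<lambda>v. v \<in> ?S)"
    unfolding two_distinguishing_def
  proof (intro notI, elim exE conjE bexE)
    fix f v assume aut: "automorphism (hypercube n) f"
      and pres: "\<forall>v \<in> pverts (hypercube n). (f v \<in> ?S) = (v \<in> ?S)"
      and v: "v \<in> pverts (hypercube n)" "f v \<noteq> v"
    obtain p c where p: "inj_on p {..<n}" "p ` {..<n} \<subseteq> {..<n}"
      and f: "\<And>v i. length v = n \<Longrightarrow> i < n \<Longrightarrow> f v ! p i = (v ! i \<noteq> c i)"
      using automorphism_hypercubeE[OF aut] by blast
    have bij_f: "bij_betw f {u. length u = n} {u. length u = n}"
      using aut by (simp add: automorphism_def)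
    have len_f: "length (f u) = n" if "length u = n" for u
      using bij_f that by (auto simp: bij_betw_def)
    have fs: "f (s r) \<in> ?S" if "r < m" for r
    proof -
      have "s r \<in> ?S"
        using that by blast
      then show ?thesis
        using bspec[OF pres, of "s r"] len_s[of r] by (simp only: pverts_hypercube mem_Collect_eq)
    qed
    have "?S \<subseteq> {u. length u = n}"
      using len_s by blast
    then have "inj_on f ?S"
      using inj_on_subset bij_betw_imp_inj_on[OF bij_f] by blast
    moreover have "f ` ?S \<subseteq> ?S"
      using fs by blast
    ultimately have bij_fS: "bij_betw f ?S ?S"
      by (simp add: bij_betw_def endo_inj_surj)
    have bij_s: "bij_betw s {..<m} ?S"
      using inj_s by (simp add: bij_betw_def)
    define t where "t = inv_into {..<m} s \<circ> f \<circ> s"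
    have t: "bij_betw t {..<m} {..<m}"
      using bij_betw_trans[OF bij_betw_trans[OF bij_s bij_fS] bij_betw_inv_into[OF bij_s]]
      by (simp add: t_def comp_assoc)
    have st: "s (t r) = f (s r)" if "r < m" for r
      using f_inv_into_f[OF fs[OF that]] by (simp add: t_def)
    have pn: "p i < n" if "i < n" for i
      using p that by auto
    have column: "t r \<in> h (p i) \<longleftrightarrow> (r \<in> h i) \<noteq> c i" if "r < m" "i < n" for r i
      using f[OF len_s that(2), of r]
      unfolding st[OF that(1), symmetric] nth_s[OF that(2)] nth_s[OF pn[OF that(2)]] .
    have "part m (t ` h i) = h (p i)" if i: "i < n" for i
    proof -
      have sub: "h (p i) \<subseteq> t ` {..<m}"
        using hsub pn[OF i] t by (simp add: bij_betw_def)
      have img: "t ` {..<m} = {..<m}"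
        using t by (simp add: bij_betw_def)
      have "h (p i) = t ` {r \<in> {..<m}. (r \<in> h i) \<noteq> c i}"
      proof (intro subset_antisym subsetI)
        fix x assume "x \<in> h (p i)"
        moreover from this obtain r where "r < m" "x = t r"
          using sub by auto
        ultimately show "x \<in> t ` {r \<in> {..<m}. (r \<in> h i) \<noteq> c i}"
          using column[OF _ i] by simp
      qed (use column[OF _ i] in auto)
      also have "{r \<in> {..<m}. (r \<in> h i) \<noteq> c i} = (if c i then {..<m} - h i else h i)"
        using hsub(1)[OF i] by auto
      also have "t ` \<dots> = (if c i then {..<m} - t ` h i else t ` h i)"
        using inj_on_image_set_diff[of t "{..<m}" "{..<m}" "h i"] t hsub(1)[OF i]
        by (simp add: bij_betw_def)
      finally have "h (p i) = (if c i then {..<m} - t ` h i else t ` h i)" .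
      moreover have "t ` h i \<subseteq> {..<m}"
        using img hsub(1)[OF i] by blast
      moreover have "0 \<notin> h (p i)"
        using hsub pn[OF i] by blast
      ultimately show ?thesis
        using \<open>0 < m\<close> by (auto simp: part_def split: if_splits)
    qed
    then have "part m (t ` A) \<in> F" if "A \<in> F" for A
      using that h hF pn by (auto simp: bij_betw_def)
    then have t_id: "t r = r" if "r < m" for r
      using rigidD[OF rigid t _ that] by blast
    have "f v ! i = v ! i" if i: "i < n" for i
    proof -
      \<comment> \<open>no column contains row 0, so a flip would be visible there\<close>
      have c: "\<not> c i"
        using column[OF \<open>0 < m\<close> i] t_id[OF \<open>0 < m\<close>] hsub(2)[OF i] hsub(2)[OF pn[OF i]] by simp
      have "h (p i) = h i"
      proof (intro set_eqI)
        fix r show "r \<in> h (p i) \<longleftrightarrow> r \<in> h i"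
          using column[of r i] t_id[of r] c hsub(1)[OF i] hsub(1)[OF pn[OF i]] i by (cases "r < m") auto
      qed
      then have "p i = i"
        using inj_on_eq_iff[OF bij_betw_imp_inj_on[OF h], of "p i" i] i pn by simp
      then show ?thesis
        using f[of v i] v i c by simp
    qed
    moreover have len_v: "length v = n"
      using v by simp
    ultimately have "f v = v"
      using len_f[OF len_v] by (intro nth_equalityI) simp_all
    then show False using v by simp
  qed
  moreover have "{v \<in> pverts (hypercube n). (v \<in> ?S) = True} = ?S"
    using len_s by auto
  then have "m = card {v \<in> pverts (hypercube n). (v \<in> ?S) = True}"
    using inj_s by (simp add: card_image)
  ultimately show ?thesis by blast
qed

section \<open>Rigid families from a path\<close>

text \<open>
  By injectivity the images of consecutive points of the path never turn back, so \<open>t\<close> walks in one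
  direction for \<open>m - 1\<close> steps. It has room for this only if it starts at an end, and starting at
  \<open>m - 1\<close> is excluded.
\<close>

lemma path_rigid:
  fixes t :: "nat \<Rightarrow> nat"
  assumes inj: "inj_on t {..<m}" and into: "t ` {..<m} \<subseteq> {..<m}"
    and step: "\<And>i. Suc i < m \<Longrightarrow> t (Suc i) = Suc (t i) \<or> t i = Suc (t (Suc i))"
    and start: "Suc (t 0) \<noteq> m" and "r < m"
  shows "t r = r"
proof (cases "m = 1")
  case True
  then show ?thesis using into \<open>r < m\<close> by auto
next
  case False
  then have m: "Suc 0 < m" using \<open>r < m\<close> by simp
  have bound: "t i < m" if "i < m" for i
    using into that by auto
  have turn: "t (Suc (Suc i)) \<noteq> t i" if "Suc (Suc i) < m" for i
    using inj_on_eq_iff[OF inj, of "Suc (Suc i)" i] that by simp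
  show ?thesis
  proof (cases "t (Suc 0) = Suc (t 0)")
    case True
    have up: "t (Suc i) = Suc (t i)" if "Suc i < m" for i
      using that
    proof (induction i)
      case (Suc i)
      then show ?case using step[of "Suc i"] turn[of i] by auto
    qed (simp add: True)
    have "t i = t 0 + i" if "i < m" for i
      using that by (induction i) (simp_all add: up)
    moreover from this[of "m - 1"] have "t 0 = 0"
      using bound[of "m - 1"] m by simp
    ultimately show ?thesis using \<open>r < m\<close> by simp
  next
    case False
    have down: "t i = Suc (t (Suc i))" if "Suc i < m" for i
      using that
    proof (induction i)
      case 0
      then show ?case using False step[of 0] by simp
    next
      case (Suc i)
      then show ?case using step[of "Suc i"] turn[of i] by auto
    qed
    have "t i + i = t 0" if "i < m" for i
      using that by (induction i) (use down in force)+
    from this[of "m - 1"] have "Suc (t 0) = m"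
      using bound[of 0] m by simp
    then show ?thesis using start by simp
  qed
qed

text \<open>
  In the construction below \<open>(m choose 2) - (m - 1) + 1\<close> bipartitions are forbidden. The bound says
  that they make up at most half of all \<open>2 ^ (m - 1)\<close>.
\<close>

lemma choose_two_bound: "m \<ge> 5 \<Longrightarrow> (m choose 2) + 2 \<le> 2 ^ (m - 2) + m"
proof (induction m rule: dec_induct)
  case base
  show ?case by (subst choose_two) simp
next
  case (step m)
  have "m \<le> 2 ^ (m - 2) + 1"
    using step(1)
  proof (induction m rule: dec_induct)
    case (step k)
    then have "Suc k - 2 = Suc (k - 2)" by simp
    then show ?case using step by simp
  qed simp
  moreover have "Suc m choose 2 = (m choose 2) + m"
    by (simp add: numeral_2_eq_2)
  moreover have "Suc m - 2 = Suc (m - 2)"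
    using step(1) by simp
  ultimately show ?case using step by simp
qed

text \<open>
  The family must contain the edges of the path and the end point \<open>{0}\<close>, and must avoid all other
  pairs and the end point \<open>{m - 1}\<close>. The remaining bipartitions serve to adjust its size. Since
  \<open>m \<ge> 5\<close>, the complement of a set with at most two elements has at least three, so no required
  bipartition is forbidden in the guise of its other side.
\<close>

lemma ex_rigid_family:
  assumes m: "m \<ge> 5" "m \<le> n" "n \<le> 2 ^ (m - 2)"
  shows "\<exists>F. rigid m F \<and> card F = n"
proof -
  define path where "path = (\<lambda>i. {i, Suc i}) ` {..<m - 1}"
  define pairs where "pairs = {A. A \<subseteq> {..<m} \<and> card A = 2}"
  define must where "must = insert {0} path"
  define bad where "bad = insert {m - 1} (pairs - path)"
  have fin: "finite pairs" "finite path"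
    by (simp_all add: pairs_def path_def)
  have path_pairs: "path \<subseteq> pairs"
    by (auto simp: path_def pairs_def)
  have must: "A \<subseteq> {..<m} \<and> card A \<le> 2" if "A \<in> must" for A
    using that path_pairs m by (auto simp: must_def pairs_def)
  have bad: "A \<subseteq> {..<m} \<and> card A \<le> 2" if "A \<in> bad" for A
    using that m by (auto simp: bad_def pairs_def)
  have disj: "must \<inter> bad = {}"
    using path_pairs m by (auto simp: must_def bad_def pairs_def)
  have card_path: "card path = m - 1"
  proof -
    have "inj_on (\<lambda>i::nat. {i, Suc i}) {..<m - 1}"
      by (auto simp: inj_on_def doubleton_eq_iff)
    then show ?thesis by (simp add: path_def card_image)
  qed
  have "card must \<le> m"
    using card_insert_le_m1[of m path "{0}"] card_path m by (simp add: must_def)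
  then have card_must: "card (part m ` must) \<le> n"
    using card_image_le[of must "part m"] fin m by (simp add: must_def)
  have "card pairs = m choose 2"
    using n_subsets[of "{..<m}" 2] by (simp add: pairs_def)
  then have "card (pairs - path) = (m choose 2) - (m - 1)"
    using card_Diff_subset[OF fin(2) path_pairs] card_path by simp
  moreover have "m - 1 \<le> m choose 2"
    using card_mono[OF fin(1) path_pairs] card_path \<open>card pairs = _\<close> by simp
  moreover have "card bad \<le> Suc (card (pairs - path))"
    unfolding bad_def by (rule card_insert_le_m1) simp_all
  ultimately have "card bad \<le> 2 ^ (m - 2)"
    using choose_two_bound[OF m(1)] m by linarith
  moreover have "card (part m ` bad) \<le> card bad"
    using fin by (intro card_image_le) (simp add: bad_def)
  moreover have "(2::nat) ^ (m - 1) = 2 ^ (m - 2) + 2 ^ (m - 2)"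
  proof -
    have "m - 1 = Suc (m - 2)" using m by simp
    then show ?thesis by simp
  qed
  moreover have "card (Pow {1..<m} - part m ` bad) \<ge> card (Pow {1..<m}) - card (part m ` bad)"
    by (rule diff_card_le_card_Diff) (use fin in \<open>simp add: bad_def\<close>)
  ultimately have card_good: "n \<le> card (Pow {1..<m} - part m ` bad)"
    using m by (simp add: card_Pow)
  have "part m ` must \<subseteq> Pow {1..<m} - part m ` bad"
  proof -
    have "part m A \<noteq> part m B" if AB: "A \<in> must" "B \<in> bad" for A B
    proof
      assume "part m A = part m B"
      then have "A = B \<or> A = {..<m} - B"
        using must bad AB by (intro part_eqD) auto
      moreover have "card ({..<m} - B) \<ge> 3"
        using bad[OF AB(2)] m by (subst card_Diff_subset) (auto intro: finite_subset)
      ultimately show False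
        using must[OF AB(1)] disj AB by auto
    qed
    then show ?thesis using part_subset must by blast
  qed
  then obtain F where F: "part m ` must \<subseteq> F" "F \<subseteq> Pow {1..<m} - part m ` bad" "card F = n"
    using exists_subset_between[of "part m ` must" n "Pow {1..<m} - part m ` bad"] card_must card_good
    by auto
  have "t r = r" if t: "bij_betw t {..<m} {..<m}" and pres: "\<forall>A \<in> F. part m (t ` A) \<in> F"
    and "r < m" for t r
  proof -
    have inj: "inj_on t {..<m}" and into: "t ` {..<m} \<subseteq> {..<m}"
      using t by (auto simp: bij_betw_def)
    have image: "t ` A \<notin> bad" if "A \<in> must" for A
    proof -
      have "part m (t ` part m A) \<in> F"
        using pres F(1) that by blast
      then have "part m (t ` A) \<in> F"
        using part_image_part[OF t] must[OF that] m by simp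
      then show ?thesis using F(2) by blast
    qed
    show ?thesis
    proof (rule path_rigid[OF inj into _ _ \<open>r < m\<close>])
      have "{t 0} \<notin> bad"
        using image[of "{0}"] by (simp add: must_def)
      then show "Suc (t 0) \<noteq> m"
        by (auto simp: bad_def)
    next
      fix i assume i: "Suc i < m"
      have "{i, Suc i} \<in> path"
        using i by (auto simp: path_def)
      then have "{t i, t (Suc i)} \<notin> bad"
        using image[of "{i, Suc i}"] by (simp add: must_def)
      moreover have "t i \<noteq> t (Suc i)"
        using inj_on_eq_iff[OF inj, of i "Suc i"] i by simp
      moreover have "t i < m" "t (Suc i) < m"
        using bij_betw_apply[OF t] i by auto
      ultimately have "{t i, t (Suc i)} \<notin> bad" "{t i, t (Suc i)} \<in> pairs"
        by (auto simp: pairs_def)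
      then have "{t i, t (Suc i)} \<in> path"
        by (simp add: bad_def)
      then show "t (Suc i) = Suc (t i) \<or> t i = Suc (t (Suc i))"
        by (auto simp: path_def doubleton_eq_iff)
    qed
  qed
  then have "rigid m F"
    using F(2) by (auto simp: rigid_def)
  then show ?thesis using F(3) by blast
qed

section \<open>The cost of 2-distinguishing hypercubes\<close>

theorem theorem13:
  fixes n :: nat
  assumes "n \<ge> 5"
  shows "int (cost2 (hypercube n)) \<in> {1 + \<lceil>log 2 (real n)\<rceil>, 2 + \<lceil>log 2 (real n)\<rceil>}"
proof -
  obtain j where j: "2 ^ j < n" "n \<le> 2 ^ (j + 1)"
    using ex_power_ivl2[of 2 n] assms by auto
  have ceil: "\<lceil>log 2 (real n)\<rceil> = int j + 1"
    using ceiling_log_nat_eq_powr_iff[of 2 n j] j assms by simp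
  have "j \<ge> 2"
  proof (rule ccontr)
    assume "\<not> j \<ge> 2"
    then have "(2::nat) ^ (j + 1) \<le> 2 ^ 2"
      by (intro power_increasing) auto
    then show False using j assms by simp
  qed
  \<comment> \<open>this provides the \<open>j + 3 \<le> n\<close> columns that the path needs\<close>
  have "j + 2 \<le> 2 ^ j"
    using \<open>j \<ge> 2\<close> by (induction j rule: dec_induct) simp_all
  then obtain F where F: "rigid (j + 3) F" "card F = n"
    using ex_rigid_family[of "j + 3" n] \<open>j \<ge> 2\<close> j by auto
  define P where "P k \<longleftrightarrow> (\<exists>l b. two_distinguishing (hypercube n) l \<and>
    k = card {v \<in> pverts (hypercube n). l v = b})" for k
  have cost: "cost2 (hypercube n) = (LEAST k. P k)"
    unfolding cost2_def P_def ..
  have "P (j + 3)"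
    unfolding P_def using F by (intro rigid_imp_two_distinguishing) simp_all
  then have upper: "cost2 (hypercube n) \<le> j + 3" and "P (cost2 (hypercube n))"
    unfolding cost by (rule Least_le, rule LeastI)
  then obtain l b where l: "two_distinguishing (hypercube n) l"
      "cost2 (hypercube n) = card {v. length v = n \<and> l v = b}"
    by (auto simp: P_def)
  have "n \<le> 2 ^ (cost2 (hypercube n) - 1)"
    using two_distinguishing_class_card[OF l(1) _ refl, of b] assms by (simp add: l(2))
  with j(1) have "(2::nat) ^ j < 2 ^ (cost2 (hypercube n) - 1)"
    by (rule less_le_trans)
  then have "j < cost2 (hypercube n) - 1"
    by simp
  then show ?thesis
    using upper ceil by auto
qed

end
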